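(* Let $a\in\mathbb{R}$ and let $f:[a,\infty)\to\mathbb{R}$. Suppose there exist a point $t_0\in(a,\infty)$ and a number $\alpha\in(0,1]$ such that the conformable derivative $T^{\alpha}_a f(t_0)$ with lower terminal $a$ exists. Then for every $\beta\in(0,1]$ with $\beta\neq\alpha$ the conformable derivative $T^{\beta}_a f(t_0)$ exists and $$T^{\alpha}_a f(t_0)=(t_0-a)^{\beta-\alpha}\,T^{\beta}_a f(t_0).$$
   Context: For $a\in\mathbb{R}$, $\alpha\in(0,1]$, a function $f:[a,\infty)\to\mathbb{R}$ and a point $t\in(a,\infty)$, the (left-sided) conformable derivative of order $\alpha$ of $f$ at $t$ with lower terminal $a$ is $$T^{\alpha}_a f(t)=\lim_{\theta\to 0}\frac{f\big(t+\theta(t-a)^{1-\alpha}\big)-f(t)}{\theta},$$ provided this (finite, two-sided) limit exists. *)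

theory Defs
  imports "HOL-Analysis.Analysis"
begin

text \<open>
  A function on \<open>[a, \<infinity>)\<close> is represented by a total function on the reals. Since the
  definitions below are only used at points \<open>t > a\<close>, and limits at \<open>\<theta> = 0\<close> depend only on
  small \<open>\<theta>\<close>, for which the argument of \<open>f\<close> stays in \<open>(a, \<infinity>)\<close>, the values of \<open>f\<close> to the left
  of \<open>a\<close> are irrelevant.
\<close>

definition conformable_quotient :: "real \<Rightarrow> real \<Rightarrow> (real \<Rightarrow> real) \<Rightarrow> real \<Rightarrow> real \<Rightarrow> real" where
  "conformable_quotient a \<alpha> f t \<theta> = (f (t + \<theta> * (t - a) powr (1 - \<alpha>)) - f t) / \<theta>"

definition conformable_differentiable :: "real \<Rightarrow> real \<Rightarrow> (real \<Rightarrow> real) \<Rightarrow> real \<Rightarrow> bool" where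
  "conformable_differentiable a \<alpha> f t \<longleftrightarrow>
     (\<exists>L. (conformable_quotient a \<alpha> f t \<longlongrightarrow> L) (at 0))"

text \<open>Meaningful only where \<^const>\<open>conformable_differentiable\<close> holds; unspecified otherwise.\<close>

definition conformable_deriv :: "real \<Rightarrow> real \<Rightarrow> (real \<Rightarrow> real) \<Rightarrow> real \<Rightarrow> real" where
  "conformable_deriv a \<alpha> f t = Lim (at 0) (conformable_quotient a \<alpha> f t)"

end

theory Submission
  imports Defs
begin

text \<open>
  The order enters the conformable quotient only through the factor \<open>(t - a) powr (1 - \<alpha>)\<close>, which
  is a positive constant for fixed \<open>t > a\<close>. Passing from \<open>\<alpha>\<close> to \<open>\<beta>\<close> multiplies this factor by
  \<open>c = (t - a) powr (\<alpha> - \<beta>)\<close>, so it amounts to the linear change of variable \<open>\<theta> \<mapsto> c * \<theta>\<close>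
  in the increment, at the price of an outer factor \<open>c\<close>
  (\<open>conformable_quotient_rescale\<close>). Since the change of variable maps punctured neighbourhoods of
  \<open>0\<close> to punctured neighbourhoods of \<open>0\<close>, a limit \<open>L\<close> of order \<open>\<alpha>\<close> yields the limit \<open>c * L\<close> of
  order \<open>\<beta>\<close> (\<open>tendsto_conformable_quotient_rescale\<close>). The inverse of \<open>c\<close> is the factor in the
  theorem.
\<close>

lemma conformable_quotient_rescale:
  fixes a t \<alpha> \<beta> \<theta> :: real
  assumes "a < t"
  defines "c \<equiv> (t - a) powr (\<alpha> - \<beta>)"
  shows "conformable_quotient a \<beta> f t \<theta> = c * conformable_quotient a \<alpha> f t (c * \<theta>)"
proof -
  have "c * (t - a) powr (1 - \<alpha>) = (t - a) powr (1 - \<beta>)"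
    unfolding c_def by (simp flip: powr_add)
  then have eq: "c * \<theta> * (t - a) powr (1 - \<alpha>) = \<theta> * (t - a) powr (1 - \<beta>)"
    by (metis mult.assoc mult.commute)
  have "c \<noteq> 0"
    using assms by simp
  then show ?thesis
    unfolding conformable_quotient_def eq by simp
qed

lemma tendsto_conformable_quotient_rescale:
  assumes "a < t" and "(conformable_quotient a \<alpha> f t \<longlongrightarrow> L) (at 0)"
  shows "(conformable_quotient a \<beta> f t \<longlongrightarrow> (t - a) powr (\<alpha> - \<beta>) * L) (at 0)"
proof -
  define c where "c = (t - a) powr (\<alpha> - \<beta>)"
  have "c \<noteq> 0"
    using assms(1) by (simp add: c_def)
  have "filterlim (\<lambda>\<theta>. c * \<theta>) (at 0) (at 0)"
    using \<open>c \<noteq> 0\<close>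
    by (auto simp: filterlim_at eventually_at_filter intro!: tendsto_eq_intros)
  then have "((\<lambda>\<theta>. c * conformable_quotient a \<alpha> f t (c * \<theta>)) \<longlongrightarrow> c * L) (at 0)"
    by (intro tendsto_mult_left filterlim_compose[OF assms(2)])
  moreover have "conformable_quotient a \<beta> f t = (\<lambda>\<theta>. c * conformable_quotient a \<alpha> f t (c * \<theta>))"
    unfolding c_def by (intro ext conformable_quotient_rescale assms(1))
  ultimately show ?thesis
    by (simp add: c_def)
qed

lemma conformable_deriv_eqI:
  "(conformable_quotient a \<alpha> f t \<longlongrightarrow> L) (at 0) \<Longrightarrow> conformable_deriv a \<alpha> f t = L"
  unfolding conformable_deriv_def by (rule tendsto_Lim) simp_all

theorem theorem3p3:
  fixes a t\<^sub>0 \<alpha> :: real and f :: "real \<Rightarrow> real"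
  assumes "t\<^sub>0 \<in> {a<..}"
    and "\<alpha> \<in> {0<..1}"
    and "conformable_differentiable a \<alpha> f t\<^sub>0"
  shows "\<forall>\<beta>\<in>{0<..1}. \<beta> \<noteq> \<alpha> \<longrightarrow>
           conformable_differentiable a \<beta> f t\<^sub>0 \<and>
           conformable_deriv a \<alpha> f t\<^sub>0
             = (t\<^sub>0 - a) powr (\<beta> - \<alpha>) * conformable_deriv a \<beta> f t\<^sub>0"
proof (intro ballI impI)
  fix \<beta> :: real
  have "a < t\<^sub>0"
    using assms(1) by simp
  obtain L where L: "(conformable_quotient a \<alpha> f t\<^sub>0 \<longlongrightarrow> L) (at 0)"
    using assms(3) by (auto simp: conformable_differentiable_def)
  note L' = tendsto_conformable_quotient_rescale[OF \<open>a < t\<^sub>0\<close> L, of \<beta>]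
  have "(t\<^sub>0 - a) powr (\<beta> - \<alpha>) * (t\<^sub>0 - a) powr (\<alpha> - \<beta>) = 1"
    using \<open>a < t\<^sub>0\<close> by (simp flip: powr_add)
  then have "L = (t\<^sub>0 - a) powr (\<beta> - \<alpha>) * ((t\<^sub>0 - a) powr (\<alpha> - \<beta>) * L)"
    by (simp flip: mult.assoc)
  then show "conformable_differentiable a \<beta> f t\<^sub>0 \<and>
      conformable_deriv a \<alpha> f t\<^sub>0 = (t\<^sub>0 - a) powr (\<beta> - \<alpha>) * conformable_deriv a \<beta> f t\<^sub>0"
    using L' conformable_deriv_eqI[OF L] conformable_deriv_eqI[OF L']
    by (auto simp: conformable_differentiable_def)
qed

end
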